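(* Let $F:\mathbb R^{d}\to\mathbb R$ be differentiable with $L$-Lipschitz gradient, $\|\nabla F(\boldsymbol x)-\nabla F(\boldsymbol y)\|\le L\|\boldsymbol x-\boldsymbol y\|$ for all $\boldsymbol x,\boldsymbol y\in\mathbb R^d$, with $L>0$, and let $\boldsymbol\xi^*$ be a minimizer of $F$. Suppose $F$ satisfies the Polyak--Łojasiewicz inequality $\frac12\|\nabla F(\boldsymbol x)\|^2\ge\mu\,(F(\boldsymbol x)-F(\boldsymbol\xi^* ))$ for all $\boldsymbol x\in\mathbb R^d$ with a constant $\mu>0$. Let $0\le\epsilon<1$, and let $(\boldsymbol\xi_k)_{k\ge0}$ be random vectors generated by $\boldsymbol\xi_{k+1}=\boldsymbol\xi_k-\eta\boldsymbol\upsilon_k$ with $\eta=1/L$, where the random gradient estimates $\boldsymbol\upsilon_k$ satisfy $\mathbb E\|\boldsymbol\upsilon_k-\nabla F(\boldsymbol\xi_k)\|^2\le\epsilon^2\,\mathbb E\|\nabla F(\boldsymbol\xi_k)\|^2$ for all $k$. Then, for all $k\ge0$, $$\mathbb E[F(\boldsymbol\xi_{k+1})-F(\boldsymbol\xi^* )]\le\Big(1-(1-\epsilon^2)\frac{\mu}{L}\Big)^{k+1}\,\mathbb E[F(\boldsymbol\xi_0)-F(\boldsymbol\xi^* )].$$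
   Context: All expectations appearing are assumed finite. No unbiasedness or independence of $\boldsymbol\upsilon_k$ is assumed. *)

theory Defs
  imports "HOL-Probability.Probability"
begin

end

theory Submission
  imports Defs
begin

text \<open>
  Fix an outcome and write \<open>g\<close> for the gradient at the current iterate and \<open>v\<close> for its
  estimate. An \<open>L\<close>-Lipschitz gradient puts \<open>F\<close> below a paraboloid touching its graph at
  the current iterate (\<open>descent_lemma\<close>). Evaluated after a step of size \<open>1 / L\<close>
  along \<open>- v\<close>, the cross terms complete to a square, so that
  \<open>F\<close> changes by at most \<open>(\<parallel>v - g\<parallel>\<^sup>2 - \<parallel>g\<parallel>\<^sup>2) / (2 * L)\<close> (\<open>inexact_gradient_step\<close>).
  The inner product of \<open>v\<close> with \<open>g\<close>, the one term that second moments of \<open>v - g\<close> and \<open>g\<close>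
  do not determine, has been absorbed, so the estimate survives taking expectations.

  In expectation the error is at most \<open>\<epsilon>\<^sup>2\<close> times the squared gradient, which leaves a decrease
  of at least \<open>(1 - \<epsilon>\<^sup>2) / (2 * L)\<close> times the expected squared gradient. The
  Polyak-Lojasiewicz inequality turns it into a fraction \<open>(1 - \<epsilon>\<^sup>2) * (\<mu> / L)\<close> of the
  expected gap, so the expected gap contracts at every step.

  The contraction factor may be negative (a constant \<open>F\<close> satisfies the hypotheses for every
  \<open>\<mu>\<close>), so multiplying inequalities by it needs care. The expected gaps are nonnegative, though,
  and nonnegative numbers that shrink by a negative factor all vanish
  (\<open>nonneg_contraction_le_power\<close>).
\<close>

text \<open>
  Along the segment from \<open>x\<close> to \<open>y\<close>, the difference between \<open>F\<close> and the paraboloid starts at 0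
  and, by the Cauchy-Schwarz inequality, has nonpositive derivative.
\<close>

lemma descent_lemma:
  fixes F :: "'a::real_inner \<Rightarrow> real" and g :: "'a \<Rightarrow> 'a"
  assumes grad: "\<And>x. GDERIV F x :> g x"
    and lipschitz: "\<And>x y. norm (g x - g y) \<le> L * norm (x - y)"
  shows "F y \<le> F x + g x \<bullet> (y - x) + L / 2 * (norm (y - x))\<^sup>2"
proof -
  define h where "h = y - x"
  define \<phi> where "\<phi> t = F (x + t *\<^sub>R h) - t * (g x \<bullet> h) - L / 2 * t\<^sup>2 * (norm h)\<^sup>2" for t :: real
  define \<phi>' where "\<phi>' t = g (x + t *\<^sub>R h) \<bullet> h - g x \<bullet> h - L * t * (norm h)\<^sup>2" for t :: real
  have deriv: "(\<phi> has_real_derivative \<phi>' t) (at t)" for t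
  proof -
    have line: "((\<lambda>t. x + t *\<^sub>R h) has_derivative (\<lambda>s. s *\<^sub>R h)) (at t)"
      by (auto intro!: derivative_eq_intros)
    have "(F has_derivative (\<lambda>z. g (x + t *\<^sub>R h) \<bullet> z)) (at (x + t *\<^sub>R h))"
      using grad[of "x + t *\<^sub>R h"] by (simp add: gderiv_def inner_commute)
    from has_derivative_compose[OF line this]
    have "((\<lambda>t. F (x + t *\<^sub>R h)) has_real_derivative g (x + t *\<^sub>R h) \<bullet> h) (at t)"
      by (simp add: has_field_derivative_def mult.commute[of _ "g (x + t *\<^sub>R h) \<bullet> h"])
    then show ?thesis
      unfolding \<phi>_def \<phi>'_def by (auto intro!: derivative_eq_intros)
  qed
  have nonpos: "\<phi>' t \<le> 0" if "0 \<le> t" for t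
  proof -
    have "(g (x + t *\<^sub>R h) - g x) \<bullet> h \<le> norm (g (x + t *\<^sub>R h) - g x) * norm h"
      by (rule norm_cauchy_schwarz)
    also have "\<dots> \<le> L * norm (t *\<^sub>R h) * norm h"
      using lipschitz[of "x + t *\<^sub>R h" x] by (intro mult_right_mono) auto
    also have "\<dots> = L * t * (norm h)\<^sup>2"
      using that by (simp add: power2_eq_square)
    finally show ?thesis
      by (simp add: \<phi>'_def inner_diff_left)
  qed
  have "\<phi> 1 \<le> \<phi> 0"
    by (rule DERIV_nonpos_imp_nonincreasing) (use deriv nonpos in auto)
  then show ?thesis
    by (simp add: \<phi>_def h_def)
qed

text \<open>
  Completing the square:
  \<open>\<parallel>v\<parallel>\<^sup>2 - 2 * (g \<bullet> v) = \<parallel>v - g\<parallel>\<^sup>2 - \<parallel>g\<parallel>\<^sup>2\<close>. The step size \<open>1 / L\<close> is what gives the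
  linear and the quadratic term of the paraboloid the ratio needed for this.
\<close>

lemma inexact_gradient_step:
  fixes F :: "'a::real_inner \<Rightarrow> real" and g :: "'a \<Rightarrow> 'a"
  assumes grad: "\<And>x. GDERIV F x :> g x"
    and lipschitz: "\<And>x y. norm (g x - g y) \<le> L * norm (x - y)"
    and L_pos: "L > 0"
  shows "F (x - (1 / L) *\<^sub>R v) \<le> F x + ((norm (v - g x))\<^sup>2 - (norm (g x))\<^sup>2) / (2 * L)"
proof -
  have "F (x - (1 / L) *\<^sub>R v)
      \<le> F x + g x \<bullet> (- ((1 / L) *\<^sub>R v)) + L / 2 * (norm ((1 / L) *\<^sub>R v))\<^sup>2"
    using descent_lemma[OF grad lipschitz, of "x - (1 / L) *\<^sub>R v" x] by simp
  also have "\<dots> = F x + ((norm v)\<^sup>2 - 2 * (g x \<bullet> v)) / (2 * L)"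
    using L_pos by (simp add: field_simps power2_eq_square)
  also have "(norm v)\<^sup>2 - 2 * (g x \<bullet> v) = (norm (v - g x))\<^sup>2 - (norm (g x))\<^sup>2"
    by (simp add: power2_norm_eq_inner inner_diff_left inner_diff_right inner_commute)
  finally show ?thesis .
qed

text \<open>
  A factor \<open>q < 0\<close> is harmless: \<open>0 \<le> a (Suc k) \<le> q * a k\<close> then forces \<open>a k = 0\<close>, for every \<open>k\<close>.
\<close>

lemma nonneg_contraction_le_power:
  fixes a :: "nat \<Rightarrow> real"
  assumes nonneg: "\<And>k. 0 \<le> a k" and step: "\<And>k. a (Suc k) \<le> q * a k"
  shows "a k \<le> q ^ k * a 0"
proof (cases "0 \<le> q")
  case True
  show ?thesis
  proof (induction k)
    case 0
    show ?case by simp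
  next
    case (Suc k)
    have "a (Suc k) \<le> q * a k" by (rule step)
    also have "\<dots> \<le> q * (q ^ k * a 0)" using Suc True by (rule mult_left_mono)
    finally show ?case by (simp add: mult.assoc)
  qed
next
  case False
  have "a k = 0" for k
  proof -
    have "0 \<le> q * a k" using nonneg[of "Suc k"] step[of k] by linarith
    then show ?thesis using False nonneg[of k] by (auto simp: zero_le_mult_iff)
  qed
  then show ?thesis by simp
qed

theorem proposition2:
  fixes F :: "real ^ 'd \<Rightarrow> real"
    and gradF :: "real ^ 'd \<Rightarrow> real ^ 'd"
    and \<xi>star :: "real ^ 'd"
    and L \<mu> \<epsilon> \<eta> :: real
    and M :: "'w measure"
    and \<xi> \<upsilon> :: "nat \<Rightarrow> 'w \<Rightarrow> real ^ 'd"
  assumes grad: "\<And>x. GDERIV F x :> gradF x"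
    and L_pos: "L > 0"
    and grad_lipschitz: "\<And>x y. norm (gradF x - gradF y) \<le> L * norm (x - y)"
    and minimizer: "\<And>x. F \<xi>star \<le> F x"
    and \<mu>_pos: "\<mu> > 0"
    and PL: "\<And>x. 1 / 2 * (norm (gradF x))\<^sup>2 \<ge> \<mu> * (F x - F \<xi>star)"
    and \<epsilon>_nonneg: "0 \<le> \<epsilon>"
    and \<epsilon>_less_1: "\<epsilon> < 1"
    and prob: "prob_space M"
    and \<xi>_random: "\<And>k. \<xi> k \<in> borel_measurable M"
    and \<upsilon>_random: "\<And>k. \<upsilon> k \<in> borel_measurable M"
    and step_size: "\<eta> = 1 / L"
    and iteration: "\<And>k. AE \<omega> in M. \<xi> (Suc k) \<omega> = \<xi> k \<omega> - \<eta> *\<^sub>R \<upsilon> k \<omega>"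
    and gap_integrable: "\<And>k. integrable M (\<lambda>\<omega>. F (\<xi> k \<omega>) - F \<xi>star)"
    and error_integrable: "\<And>k. integrable M (\<lambda>\<omega>. (norm (\<upsilon> k \<omega> - gradF (\<xi> k \<omega>)))\<^sup>2)"
    and grad_integrable: "\<And>k. integrable M (\<lambda>\<omega>. (norm (gradF (\<xi> k \<omega>)))\<^sup>2)"
    and error_bound:
      "\<And>k. prob_space.expectation M (\<lambda>\<omega>. (norm (\<upsilon> k \<omega> - gradF (\<xi> k \<omega>)))\<^sup>2)
         \<le> \<epsilon>\<^sup>2 * prob_space.expectation M (\<lambda>\<omega>. (norm (gradF (\<xi> k \<omega>)))\<^sup>2)"
  shows "\<forall>k. prob_space.expectation M (\<lambda>\<omega>. F (\<xi> (k + 1) \<omega>) - F \<xi>star)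
           \<le> (1 - (1 - \<epsilon>\<^sup>2) * (\<mu> / L)) ^ (k + 1)
             * prob_space.expectation M (\<lambda>\<omega>. F (\<xi> 0 \<omega>) - F \<xi>star)"
proof
  fix k
  interpret prob_space M by (rule prob)
  define gap where "gap j = expectation (\<lambda>\<omega>. F (\<xi> j \<omega>) - F \<xi>star)" for j
  define G where "G j = expectation (\<lambda>\<omega>. (norm (gradF (\<xi> j \<omega>)))\<^sup>2)" for j
  define err where "err j = expectation (\<lambda>\<omega>. (norm (\<upsilon> j \<omega> - gradF (\<xi> j \<omega>)))\<^sup>2)" for j
  note integrable = gap_integrable error_integrable grad_integrable

  have gap_nonneg: "0 \<le> gap j" for j
    unfolding gap_def using minimizer by (intro integral_nonneg_AE) simp

  have gap_step: "gap (Suc j) \<le> gap j + (err j - G j) / (2 * L)" for j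
  proof -
    have "gap (Suc j) \<le> expectation (\<lambda>\<omega>. (F (\<xi> j \<omega>) - F \<xi>star)
        + ((norm (\<upsilon> j \<omega> - gradF (\<xi> j \<omega>)))\<^sup>2 - (norm (gradF (\<xi> j \<omega>)))\<^sup>2) / (2 * L))"
      unfolding gap_def
    proof (rule integral_mono_AE)
      show "AE \<omega> in M. F (\<xi> (Suc j) \<omega>) - F \<xi>star \<le> (F (\<xi> j \<omega>) - F \<xi>star)
          + ((norm (\<upsilon> j \<omega> - gradF (\<xi> j \<omega>)))\<^sup>2 - (norm (gradF (\<xi> j \<omega>)))\<^sup>2) / (2 * L)"
        using iteration[of j]
      proof eventually_elim
        case (elim \<omega>)
        then show ?case
          using inexact_gradient_step[OF grad grad_lipschitz L_pos, of "\<xi> j \<omega>" "\<upsilon> j \<omega>"]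
          by (simp add: step_size)
      qed
    qed (intro integrable Bochner_Integration.integrable_add
        Bochner_Integration.integrable_diff integrable_divide_zero)+
    also have "\<dots> = gap j + (err j - G j) / (2 * L)"
      unfolding gap_def G_def err_def
      by (simp only: Bochner_Integration.integral_add Bochner_Integration.integral_diff[of M "\<lambda>\<omega>. (norm (\<upsilon> j \<omega> - gradF (\<xi> j \<omega>)))\<^sup>2"]
          integral_divide_zero integrable Bochner_Integration.integrable_diff integrable_divide_zero)
    finally show ?thesis .
  qed

  have PL_mean: "2 * \<mu> * gap j \<le> G j" for j
  proof -
    have "expectation (\<lambda>\<omega>. 2 * \<mu> * (F (\<xi> j \<omega>) - F \<xi>star)) \<le> G j"
      unfolding G_def
    proof (rule integral_mono)
      show "2 * \<mu> * (F (\<xi> j \<omega>) - F \<xi>star) \<le> (norm (gradF (\<xi> j \<omega>)))\<^sup>2" for \<omega>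
        using PL[of "\<xi> j \<omega>"] by simp
    qed (intro integrable integrable_mult_right)+
    then show ?thesis by (simp add: gap_def)
  qed

  have contraction: "gap (Suc j) \<le> (1 - (1 - \<epsilon>\<^sup>2) * (\<mu> / L)) * gap j" for j
  proof -
    have \<epsilon>_sq: "\<epsilon>\<^sup>2 \<le> 1"
      using \<epsilon>_nonneg \<epsilon>_less_1 by (simp add: power_le_one)
    have "err j - G j \<le> - ((1 - \<epsilon>\<^sup>2) * G j)"
      using error_bound[of j] by (simp add: err_def G_def algebra_simps)
    also have "\<dots> \<le> - ((1 - \<epsilon>\<^sup>2) * (2 * \<mu> * gap j))"
      using mult_left_mono[OF PL_mean[of j], of "1 - \<epsilon>\<^sup>2"] \<epsilon>_sq by simp
    finally have "(err j - G j) / (2 * L) \<le> - ((1 - \<epsilon>\<^sup>2) * (2 * \<mu> * gap j)) / (2 * L)"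
      using L_pos by (intro divide_right_mono) auto
    with gap_step[of j]
    have "gap (Suc j) \<le> gap j + - ((1 - \<epsilon>\<^sup>2) * (2 * \<mu> * gap j)) / (2 * L)"
      by linarith
    also have "\<dots> = (1 - (1 - \<epsilon>\<^sup>2) * (\<mu> / L)) * gap j"
      using L_pos by (simp add: field_simps)
    finally show ?thesis .
  qed

  have "gap (k + 1) \<le> (1 - (1 - \<epsilon>\<^sup>2) * (\<mu> / L)) ^ (k + 1) * gap 0"
    using gap_nonneg contraction by (rule nonneg_contraction_le_power)
  then show "expectation (\<lambda>\<omega>. F (\<xi> (k + 1) \<omega>) - F \<xi>star)
      \<le> (1 - (1 - \<epsilon>\<^sup>2) * (\<mu> / L)) ^ (k + 1) * expectation (\<lambda>\<omega>. F (\<xi> 0 \<omega>) - F \<xi>star)"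
    by (simp only: gap_def)
qed

end
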